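(* Let $P$ be a locally finite poset, with connected components $P_1,\dots,P_k$, let $\mathbb{F}$ be a field, $G$ a group, $\mathcal{A}=I(P,\mathbb{F})$ the incidence algebra of $P$ over $\mathbb{F}$, and let $\theta,\mu\in G_e^P$. Then $\mathcal{A}^\theta\cong\mathcal{A}^\mu$ as elementary $G$-graded algebras if, and only if, $\theta\sim\mu$.
   Context: The incidence algebra $I(P,\mathbb{F})$ of a locally finite poset $(P,\preceq)$ (every segment $[x,z]=\{y\in P: x\preceq y\preceq z\}$ is finite) is the $\mathbb{F}$-algebra of all functions $f:P\times P\to\mathbb{F}$ with $f(x,y)=0$ whenever $x\not\preceq y$, with pointwise addition and scalar multiplication and product $(f_1f_2)(x,y)=\sum_{x\preceq z\preceq y}f_1(x,z)f_2(z,y)$. $G^P$ is the set of all functions $\theta:P\to G$, $x\mapsto\theta_x=\theta(x)$. For $\theta\in G^P$ and $g\in G$, put $\mathcal{A}^\theta(g)=\{f\in\mathcal{A}: f(x,y)=0 \text{ whenever } x\preceq y \text{ and } \theta_x^{-1}\theta_y\neq g\}$. Let $G_\theta=\{\theta_x^{-1}\theta_y: x,y\in P,\ x\preceq y\}$ and $G_e^P=\{\theta\in G^P: G_\theta\text{ is finite}\}$. For $\theta\in G_e^P$ the subspaces $\mathcal{A}^\theta(g)$ form a $G$-grading $\mathcal{A}=\bigoplus_{g\in G}\mathcal{A}^\theta(g)$, called an elementary grading, and $\mathcal{A}^\theta$ denotes $\mathcal{A}$ with this grading. An isomorphism of $G$-graded algebras is an $\mathbb{F}$-algebra isomorphism mapping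 the component of degree $g$ onto the component of degree $g$ for all $g\in G$. Two elements $x,y\in P$ are connected if there are $x=x_0,x_1,\dots,x_n=y$ in $P$ with $x_{i-1}\preceq x_i$ or $x_i\preceq x_{i-1}$ for each $i=1,\dots,n$; the classes of this equivalence relation are the connected components of $P$. Let $P=\bigcup_{1\le i\le k}P_i$ be the decomposition of $P$ into its connected components. The group $G^k=G\times\cdots\times G$ ($k$ factors) acts on the left of $G_e^P$ by $(\mathbf{h}\theta)(x)=h_i\,\theta(x)$ if $x\in P_i$, for $\mathbf{h}=(h_1,\dots,h_k)\in G^k$. For $\sigma\in\mathrm{Aut}(P)$ (the group of order automorphisms of $P$) and $\theta\in G_e^P$, $\theta\sigma\in G_e^P$ is given by $(\theta\sigma)(x)=\theta(\sigma^{-1}(x))$. The equivalence relation $\sim$ on $G_e^P$ is: $\theta\sim\mu$ if and only if $\theta=\mathbf{h}\mu\sigma$ for some $\mathbf{h}\in G^k$ and $\sigma\in\mathrm{Aut}(P)$ (bracketing $\mathbf{h}\mu\sigma$ as $\mathbf{h}(\mu\sigma)$ or $(\mathbf{h}\mu)\sigma$ gives the same relation). *)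

theory Defs
  imports "HOL-Algebra.Algebra"
begin

text \<open>
  A poset is a carrier set \<open>P\<close> with a relation \<open>r\<close> such that
  \<^term>\<open>partial_order_on P r\<close>; this entails \<^prop>\<open>r \<subseteq> P \<times> P\<close>, and
  \<^prop>\<open>(x, y) \<in> r\<close> stands for \<open>x \<preceq> y\<close>.
\<close>

definition segment :: "'p set \<Rightarrow> 'p rel \<Rightarrow> 'p \<Rightarrow> 'p \<Rightarrow> 'p set" where
  "segment P r x z = {y \<in> P. (x, y) \<in> r \<and> (y, z) \<in> r}"

definition locally_finite_poset :: "'p set \<Rightarrow> 'p rel \<Rightarrow> bool" where
  "locally_finite_poset P r \<longleftrightarrow>
     partial_order_on P r \<and> (\<forall>x\<in>P. \<forall>z\<in>P. finite (segment P r x z))"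

text \<open>
  A function on \<open>P \<times> P\<close> is represented by its extension by zero to the whole type. Since
  \<^prop>\<open>r \<subseteq> P \<times> P\<close>, the two requirements \<open>f x y = \<zero>\<close> outside \<open>P \<times> P\<close> and
  \<open>f x y = \<zero>\<close> for \<open>x, y \<in> P\<close> with \<open>x \<preceq> y\<close> false amount to the single one below. In the product,
  the segment is empty when \<open>x \<preceq> y\<close> is false, so that the sum is then zero.
\<close>

definition incidence_algebra ::
  "('f, 'm) ring_scheme \<Rightarrow> 'p set \<Rightarrow> 'p rel \<Rightarrow> ('f, 'p \<Rightarrow> 'p \<Rightarrow> 'f) module" where
  "incidence_algebra F P r =
     \<lparr>carrier = {f. (\<forall>x y. f x y \<in> carrier F) \<and> (\<forall>x y. (x, y) \<notin> r \<longrightarrow> f x y = \<zero>\<^bsub>F\<^esub>)},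
      monoid.mult = (\<lambda>f1 f2 x y. \<Oplus>\<^bsub>F\<^esub>z\<in>segment P r x y. f1 x z \<otimes>\<^bsub>F\<^esub> f2 z y),
      monoid.one = (\<lambda>x y. if x \<in> P \<and> x = y then \<one>\<^bsub>F\<^esub> else \<zero>\<^bsub>F\<^esub>),
      ring.zero = (\<lambda>x y. \<zero>\<^bsub>F\<^esub>),
      ring.add = (\<lambda>f1 f2 x y. f1 x y \<oplus>\<^bsub>F\<^esub> f2 x y),
      module.smult = (\<lambda>a f x y. a \<otimes>\<^bsub>F\<^esub> f x y)\<rparr>"

text \<open>The set \<open>G\<^sub>\<theta>\<close> and the set \<open>G\<^sub>e\<^sup>P\<close>; maps \<open>P \<rightarrow> G\<close> are taken extensional on \<open>P\<close>.\<close>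

definition degree_set ::
  "('g, 'n) monoid_scheme \<Rightarrow> 'p rel \<Rightarrow> ('p \<Rightarrow> 'g) \<Rightarrow> 'g set" where
  "degree_set G r \<theta> = {inv\<^bsub>G\<^esub> (\<theta> x) \<otimes>\<^bsub>G\<^esub> \<theta> y | x y. (x, y) \<in> r}"

definition elementary_maps ::
  "('g, 'n) monoid_scheme \<Rightarrow> 'p set \<Rightarrow> 'p rel \<Rightarrow> ('p \<Rightarrow> 'g) set" where
  "elementary_maps G P r = {\<theta> \<in> P \<rightarrow>\<^sub>E carrier G. finite (degree_set G r \<theta>)}"

text \<open>The homogeneous component \<open>\<A>\<^sup>\<theta>(g)\<close> of \<open>\<A> = I(P, F)\<close>.\<close>

definition elementary_grading ::
  "('f, 'm) ring_scheme \<Rightarrow> ('g, 'n) monoid_scheme \<Rightarrow> 'p set \<Rightarrow> 'p rel \<Rightarrow> ('p \<Rightarrow> 'g) \<Rightarrow>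
     'g \<Rightarrow> ('p \<Rightarrow> 'p \<Rightarrow> 'f) set" where
  "elementary_grading F G P r \<theta> g =
     {f \<in> carrier (incidence_algebra F P r).
        \<forall>x y. (x, y) \<in> r \<and> inv\<^bsub>G\<^esub> (\<theta> x) \<otimes>\<^bsub>G\<^esub> \<theta> y \<noteq> g \<longrightarrow> f x y = \<zero>\<^bsub>F\<^esub>}"

text \<open>
  Isomorphism of the \<open>F\<close>-algebras \<open>A\<close> and \<open>B\<close>, graded by the families \<open>\<Gamma>\<close> and \<open>\<Delta>\<close> of subspaces
  indexed by the group \<open>G\<close>.
\<close>

definition graded_algebra_isomorphic ::
  "('f, 'm) ring_scheme \<Rightarrow> ('g, 'n) monoid_scheme \<Rightarrow>
   ('f, 'a, 'k) module_scheme \<Rightarrow> ('g \<Rightarrow> 'a set) \<Rightarrow>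
   ('f, 'b, 'l) module_scheme \<Rightarrow> ('g \<Rightarrow> 'b set) \<Rightarrow> bool" where
  "graded_algebra_isomorphic F G A \<Gamma> B \<Delta> \<longleftrightarrow>
     (\<exists>\<phi>\<in>ring_iso A B.
        (\<forall>a\<in>carrier F. \<forall>f\<in>carrier A. \<phi> (a \<odot>\<^bsub>A\<^esub> f) = a \<odot>\<^bsub>B\<^esub> \<phi> f) \<and>
        (\<forall>g\<in>carrier G. \<phi> ` \<Gamma> g = \<Delta> g))"

definition connected_components :: "'p set \<Rightarrow> 'p rel \<Rightarrow> 'p set set" where
  "connected_components P r = P // {(x, y) \<in> P \<times> P. (x, y) \<in> (r \<union> r\<inverse>)\<^sup>*}"

definition order_automorphisms :: "'p set \<Rightarrow> 'p rel \<Rightarrow> ('p \<Rightarrow> 'p) set" where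
  "order_automorphisms P r =
     {\<sigma> \<in> Bij P. \<forall>x\<in>P. \<forall>y\<in>P. (\<sigma> x, \<sigma> y) \<in> r \<longleftrightarrow> (x, y) \<in> r}"

text \<open>
  The left action of \<open>h \<in> G\<^sup>k\<close>, where \<open>C 1, \<dots>, C k\<close> enumerates the connected components,
  and the right action of an automorphism \<open>\<sigma>\<close>.
\<close>

definition left_act ::
  "('g, 'n) monoid_scheme \<Rightarrow> 'p set \<Rightarrow> nat \<Rightarrow> (nat \<Rightarrow> 'p set) \<Rightarrow> (nat \<Rightarrow> 'g) \<Rightarrow>
     ('p \<Rightarrow> 'g) \<Rightarrow> ('p \<Rightarrow> 'g)" where
  "left_act G P k C h \<theta> = (\<lambda>x\<in>P. h (THE i. i \<in> {1..k} \<and> x \<in> C i) \<otimes>\<^bsub>G\<^esub> \<theta> x)"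

definition right_act :: "'p set \<Rightarrow> ('p \<Rightarrow> 'g) \<Rightarrow> ('p \<Rightarrow> 'p) \<Rightarrow> ('p \<Rightarrow> 'g)" where
  "right_act P \<theta> \<sigma> = (\<lambda>x\<in>P. \<theta> (inv_into P \<sigma> x))"

definition elementary_equiv ::
  "('g, 'n) monoid_scheme \<Rightarrow> 'p set \<Rightarrow> 'p rel \<Rightarrow> nat \<Rightarrow> (nat \<Rightarrow> 'p set) \<Rightarrow>
     ('p \<Rightarrow> 'g) \<Rightarrow> ('p \<Rightarrow> 'g) \<Rightarrow> bool" where
  "elementary_equiv G P r k C \<theta> \<mu> \<longleftrightarrow>
     (\<exists>h\<in>carrier (product_group {1..k} (\<lambda>_. G)). \<exists>\<sigma>\<in>order_automorphisms P r.
        \<theta> = left_act G P k C h (right_act P \<mu> \<sigma>))"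

end

theory Submission
  imports Defs
begin

text \<open>
  Write \<open>E a b\<close> for the matrix units. A graded isomorphism \<open>\<phi>\<close> sends \<open>E x x\<close> to a nonzero
  idempotent \<open>\<phi> (E x x)\<close>, which has a nonzero diagonal entry because the segments are finite.
  Since \<open>E x x * A * E x x\<close> is one-dimensional, this entry sits at a unique position \<open>\<sigma> x\<close>, and
  the same construction for the inverse of \<open>\<phi>\<close> gives the inverse of \<open>\<sigma>\<close>. If \<open>\<sigma> x \<preceq> \<sigma> y\<close>, then
  \<open>\<phi> (E x x) * E (\<sigma> x) (\<sigma> y) * \<phi> (E y y)\<close> is nonzero and homogeneous, as \<open>E x x\<close> and \<open>E y y\<close>
  have trivial degree. It is the image of an element of \<open>E x x * A * E y y\<close>, so \<open>x \<preceq> y\<close> and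
  \<open>E x y\<close> has the degree of \<open>E (\<sigma> x) (\<sigma> y)\<close>. Thus \<open>\<sigma>\<close> is an automorphism of \<open>P\<close>, and
  \<open>x \<mapsto> \<theta> x * (\<mu> (\<sigma> x))\<^sup>-\<^sup>1\<close> is constant on connected components.
\<close>

section \<open>Matrix units in the incidence algebra\<close>

text \<open>The index \<open>a\<close> may lie outside \<open>S\<close> if \<open>h a\<close> is
  zero, so that entries of products with matrix units get formulas free of conditions on the
  segment.\<close>

lemma (in abelian_monoid) finsum_eq_single:
  assumes "finite S" and "h a \<in> carrier G"
    and "\<And>z. z \<in> S \<Longrightarrow> z \<noteq> a \<Longrightarrow> h z = \<zero>" and "a \<notin> S \<Longrightarrow> h a = \<zero>"
  shows "(\<Oplus>z\<in>S. h z) = h a"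
proof (cases "a \<in> S")
  case True
  have "(\<Oplus>z\<in>S. h z) = (\<Oplus>z\<in>S. if a = z then h a else \<zero>)"
    by (rule finsum_cong') (use assms in auto)
  also have "\<dots> = h a"
    by (rule finsum_singleton[where f = "\<lambda>_. h a"]) (use True assms in auto)
  finally show ?thesis .
next
  case False
  have "(\<Oplus>z\<in>S. h z) = (\<Oplus>z\<in>S. \<zero>)"
    by (rule finsum_cong') (use False assms in auto)
  then show ?thesis
    using False assms(4) by simp
qed

definition matrix_unit ::
  "('f, 'm) ring_scheme \<Rightarrow> 'p \<Rightarrow> 'p \<Rightarrow> 'p \<Rightarrow> 'p \<Rightarrow> 'f" where
  "matrix_unit F a b = (\<lambda>x y. if x = a \<and> y = b then \<one>\<^bsub>F\<^esub> else \<zero>\<^bsub>F\<^esub>)"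

locale incidence = F: field F
  for F :: "('f, 'm) ring_scheme" +
  fixes P :: "'p set" and r :: "'p rel"
  assumes locally_finite: "locally_finite_poset P r"
begin

abbreviation "A \<equiv> incidence_algebra F P r"
abbreviation "E \<equiv> matrix_unit F"

lemma
  shows rel_refl: "x \<in> P \<Longrightarrow> (x, x) \<in> r"
    and rel_antisym: "(x, y) \<in> r \<Longrightarrow> (y, x) \<in> r \<Longrightarrow> x = y"
    and rel_trans: "(x, y) \<in> r \<Longrightarrow> (y, z) \<in> r \<Longrightarrow> (x, z) \<in> r"
    and relD: "(x, y) \<in> r \<Longrightarrow> x \<in> P \<and> y \<in> P"
  using locally_finite
  unfolding locally_finite_poset_def partial_order_on_def preorder_on_def
  by (auto dest: refl_onD antisymD transD)

lemma finite_segment: "finite (segment P r x y)"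
proof (cases "x \<in> P \<and> y \<in> P")
  case True
  then show ?thesis
    using locally_finite by (auto simp: locally_finite_poset_def)
next
  case False
  then have "segment P r x y = {}"
    by (auto simp: segment_def dest: relD)
  then show ?thesis
    by simp
qed

lemma carrier_iff:
  "f \<in> carrier A \<longleftrightarrow>
     (\<forall>x y. f x y \<in> carrier F) \<and> (\<forall>x y. (x, y) \<notin> r \<longrightarrow> f x y = \<zero>\<^bsub>F\<^esub>)"
  by (simp add: incidence_algebra_def)

lemma
  assumes "f \<in> carrier A"
  shows entry_closed: "f x y \<in> carrier F"
    and entry_zero: "(x, y) \<notin> r \<Longrightarrow> f x y = \<zero>\<^bsub>F\<^esub>"
  using assms by (auto simp: carrier_iff)

lemma mult_apply: "(f \<otimes>\<^bsub>A\<^esub> g) x y = (\<Oplus>\<^bsub>F\<^esub>z\<in>segment P r x y. f x z \<otimes>\<^bsub>F\<^esub> g z y)"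
  by (simp add: incidence_algebra_def)

lemma smult_apply: "(c \<odot>\<^bsub>A\<^esub> f) x y = c \<otimes>\<^bsub>F\<^esub> f x y"
  by (simp add: incidence_algebra_def)

lemma mult_closed:
  assumes "f \<in> carrier A" "g \<in> carrier A"
  shows "f \<otimes>\<^bsub>A\<^esub> g \<in> carrier A"
proof -
  have "segment P r x y = {}" if "(x, y) \<notin> r" for x y
    using that by (auto simp: segment_def dest: rel_trans)
  then show ?thesis
    using assms by (auto simp: carrier_iff mult_apply intro!: F.finsum_closed)
qed

lemma matrix_unit_closed: "(a, b) \<in> r \<Longrightarrow> E a b \<in> carrier A"
  by (auto simp: carrier_iff matrix_unit_def)

lemma zero_closed: "(\<lambda>x y. \<zero>\<^bsub>F\<^esub>) \<in> carrier A"
  by (auto simp: carrier_iff)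

lemma matrix_unit_mult:
  assumes "(a, b) \<in> r" "g \<in> carrier A"
  shows "(E a b \<otimes>\<^bsub>A\<^esub> g) x y = (if x = a then g b y else \<zero>\<^bsub>F\<^esub>)"
proof -
  have "(E a b \<otimes>\<^bsub>A\<^esub> g) x y = E a b x b \<otimes>\<^bsub>F\<^esub> g b y"
    unfolding mult_apply using assms
    by (intro F.finsum_eq_single finite_segment)
      (auto simp: matrix_unit_def segment_def entry_closed dest: relD
        intro: entry_zero)
  then show ?thesis
    using assms by (simp add: matrix_unit_def entry_closed)
qed

text \<open>The product is column \<open>a\<close> of \<open>f\<close> times row \<open>b\<close> of
  \<open>g\<close>, so over a field an entry is nonzero as soon as both factors are.\<close>

lemma matrix_unit_sandwich:
  assumes "(a, b) \<in> r" "f \<in> carrier A" "g \<in> carrier A"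
  shows "(f \<otimes>\<^bsub>A\<^esub> (E a b \<otimes>\<^bsub>A\<^esub> g)) x y = f x a \<otimes>\<^bsub>F\<^esub> g b y"
proof -
  have "(f \<otimes>\<^bsub>A\<^esub> (E a b \<otimes>\<^bsub>A\<^esub> g)) x y = f x a \<otimes>\<^bsub>F\<^esub> (E a b \<otimes>\<^bsub>A\<^esub> g) a y"
    unfolding mult_apply[of f]
  proof (rule F.finsum_eq_single)
    \<comment> \<open>If \<open>x \<preceq> a\<close> holds, then \<open>a \<preceq> y\<close>
      fails, and so does \<open>b \<preceq> y\<close> because \<open>a \<preceq> b\<close>; in
      either case a factor is off the support.\<close>
    assume "a \<notin> segment P r x y"
    then have "(x, a) \<notin> r \<or> (b, y) \<notin> r"
      using assms(1) by (auto simp: segment_def dest: relD rel_trans)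
    then show "f x a \<otimes>\<^bsub>F\<^esub> (E a b \<otimes>\<^bsub>A\<^esub> g) a y = \<zero>\<^bsub>F\<^esub>"
      using assms by (auto simp: matrix_unit_mult entry_zero entry_closed)
  qed (use assms in \<open>auto simp: finite_segment matrix_unit_mult entry_closed\<close>)
  then show ?thesis
    using assms by (simp add: matrix_unit_mult)
qed

lemma mult_matrix_unit:
  assumes "b \<in> P" "f \<in> carrier A"
  shows "(f \<otimes>\<^bsub>A\<^esub> E b b) x y = (if y = b then f x b else \<zero>\<^bsub>F\<^esub>)"
proof -
  have "(f \<otimes>\<^bsub>A\<^esub> E b b) x y = f x b \<otimes>\<^bsub>F\<^esub> E b b b y"
    unfolding mult_apply using assms
    by (intro F.finsum_eq_single finite_segment)
      (auto simp: matrix_unit_def segment_def entry_closed rel_refl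
        intro: entry_zero)
  then show ?thesis
    using assms by (simp add: matrix_unit_def entry_closed)
qed

text \<open>This Peirce corner lies in the span of one matrix unit. When
  \<open>a \<preceq> b\<close> fails, \<open>E a b\<close> is outside the algebra, but the
  coefficient \<open>f a b\<close> is then zero and both sides vanish.\<close>

lemma corner:
  assumes "a \<in> P" "b \<in> P" "f \<in> carrier A"
  shows "E a a \<otimes>\<^bsub>A\<^esub> (f \<otimes>\<^bsub>A\<^esub> E b b) = f a b \<odot>\<^bsub>A\<^esub> E a b"
proof (intro ext)
  fix x y
  have "f \<otimes>\<^bsub>A\<^esub> E b b \<in> carrier A"
    using assms by (simp add: mult_closed matrix_unit_closed rel_refl)
  then show "(E a a \<otimes>\<^bsub>A\<^esub> (f \<otimes>\<^bsub>A\<^esub> E b b)) x y = (f a b \<odot>\<^bsub>A\<^esub> E a b) x y"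
    using assms
    by (simp add: matrix_unit_mult rel_refl mult_matrix_unit smult_apply)
      (simp add: matrix_unit_def entry_closed)
qed

text \<open>
  If the diagonal vanished, then \<open>f x y = (f * f) x y\<close> would only involve entries of \<open>f\<close> over
  strictly smaller segments.
\<close>

lemma idempotent_diagonal:
  assumes f: "f \<in> carrier A" and idem: "f \<otimes>\<^bsub>A\<^esub> f = f"
    and diag: "\<And>x. x \<in> P \<Longrightarrow> f x x = \<zero>\<^bsub>F\<^esub>"
  shows "f x y = \<zero>\<^bsub>F\<^esub>"
proof (induction "card (segment P r x y)" arbitrary: x y rule: less_induct)
  case less
  have "f x z \<otimes>\<^bsub>F\<^esub> f z y = \<zero>\<^bsub>F\<^esub>" if z: "z \<in> segment P r x y" for z
  proof (cases "z = y")
    case True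
    then show ?thesis
      using z f diag by (simp add: segment_def entry_closed)
  next
    case False
    have "y \<in> segment P r x y" "y \<notin> segment P r x z" "segment P r x z \<subseteq> segment P r x y"
      using z False by (auto simp: segment_def dest: rel_trans rel_antisym relD rel_refl)
    then have "card (segment P r x z) < card (segment P r x y)"
      by (intro psubset_card_mono finite_segment) auto
    then show ?thesis
      using less f by (simp add: entry_closed)
  qed
  then have "(f \<otimes>\<^bsub>A\<^esub> f) x y = (\<Oplus>\<^bsub>F\<^esub>z\<in>segment P r x y. \<zero>\<^bsub>F\<^esub>)"
    unfolding mult_apply by (intro F.finsum_cong') auto
  then show ?case
    by (simp add: idem)
qed

end

section \<open>The order automorphism induced by a graded isomorphism\<close>

text \<open>\<open>\<psi>\<close> is the inverse of \<open>\<phi>\<close>. The assumptions are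
  symmetric under exchanging \<open>\<phi>\<close>, \<open>\<theta>\<close> with
  \<open>\<psi>\<close>, \<open>\<mu>\<close>, so every result about \<open>\<phi>\<close> passes to
  \<open>\<psi>\<close> through \<open>inverse\<close>.\<close>

locale graded_incidence_iso = incidence F P r + G: group G
  for F :: "('f, 'm) ring_scheme" and P :: "'p set" and r :: "'p rel"
    and G :: "('g, 'n) monoid_scheme" +
  fixes \<theta> \<mu> :: "'p \<Rightarrow> 'g" and \<phi> \<psi> :: "('p \<Rightarrow> 'p \<Rightarrow> 'f) \<Rightarrow> 'p \<Rightarrow> 'p \<Rightarrow> 'f"
  assumes theta: "\<theta> \<in> P \<rightarrow> carrier G" and mu: "\<mu> \<in> P \<rightarrow> carrier G"
    and phi_closed: "f \<in> carrier A \<Longrightarrow> \<phi> f \<in> carrier A"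
    and psi_closed: "f \<in> carrier A \<Longrightarrow> \<psi> f \<in> carrier A"
    and psi_phi: "f \<in> carrier A \<Longrightarrow> \<psi> (\<phi> f) = f"
    and phi_psi: "f \<in> carrier A \<Longrightarrow> \<phi> (\<psi> f) = f"
    and phi_mult: "f \<in> carrier A \<Longrightarrow> g \<in> carrier A \<Longrightarrow> \<phi> (f \<otimes>\<^bsub>A\<^esub> g) = \<phi> f \<otimes>\<^bsub>A\<^esub> \<phi> g"
    and psi_mult: "f \<in> carrier A \<Longrightarrow> g \<in> carrier A \<Longrightarrow> \<psi> (f \<otimes>\<^bsub>A\<^esub> g) = \<psi> f \<otimes>\<^bsub>A\<^esub> \<psi> g"
    and phi_smult: "c \<in> carrier F \<Longrightarrow> f \<in> carrier A \<Longrightarrow> \<phi> (c \<odot>\<^bsub>A\<^esub> f) = c \<odot>\<^bsub>A\<^esub> \<phi> f"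
    and psi_smult: "c \<in> carrier F \<Longrightarrow> f \<in> carrier A \<Longrightarrow> \<psi> (c \<odot>\<^bsub>A\<^esub> f) = c \<odot>\<^bsub>A\<^esub> \<psi> f"
    and phi_graded: "d \<in> carrier G \<Longrightarrow> f \<in> elementary_grading F G P r \<theta> d \<Longrightarrow>
      \<phi> f \<in> elementary_grading F G P r \<mu> d"
    and psi_graded: "d \<in> carrier G \<Longrightarrow> f \<in> elementary_grading F G P r \<mu> d \<Longrightarrow>
      \<psi> f \<in> elementary_grading F G P r \<theta> d"
begin

lemma inverse: "graded_incidence_iso F P r G \<mu> \<theta> \<psi> \<phi>"
  by unfold_locales
    (use theta mu phi_closed psi_closed psi_phi phi_psi phi_mult psi_mult phi_smult psi_smult
      phi_graded psi_graded in auto)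

text \<open>On \<open>P\<close> this will be the graph of \<open>\<sigma>\<close>; it stays a
  relation until existence and uniqueness of the position are known.\<close>

definition matched :: "'p \<Rightarrow> 'p \<Rightarrow> bool" where
  "matched x y \<longleftrightarrow> \<phi> (E x x) y y \<noteq> \<zero>\<^bsub>F\<^esub>"

lemma matched_mem: "x \<in> P \<Longrightarrow> matched x y \<Longrightarrow> y \<in> P"
  using entry_zero[of "\<phi> (E x x)" y y] relD[of y y]
  by (auto simp: matched_def phi_closed matrix_unit_closed rel_refl)

text \<open>Zero is its own multiple by the scalar zero, and \<open>\<phi>\<close> respects
  scalars.\<close>

lemma phi_zero: "\<phi> (\<lambda>x y. \<zero>\<^bsub>F\<^esub>) = (\<lambda>x y. \<zero>\<^bsub>F\<^esub>)"
proof -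
  have zero: "\<zero>\<^bsub>F\<^esub> \<odot>\<^bsub>A\<^esub> f = (\<lambda>x y. \<zero>\<^bsub>F\<^esub>)" if "f \<in> carrier A" for f
    using that by (intro ext) (simp add: smult_apply entry_closed)
  show ?thesis
    using phi_smult[OF F.zero_closed zero_closed] zero[OF zero_closed]
      zero[OF phi_closed[OF zero_closed]] by simp
qed

lemma matched_exists:
  assumes x: "x \<in> P"
  shows "\<exists>y. matched x y"
proof (rule ccontr)
  assume none: "\<nexists>y. matched x y"
  note unit = matrix_unit_closed[OF rel_refl[OF x]]
  have "E x x \<otimes>\<^bsub>A\<^esub> E x x = E x x"
    using x unit by (intro ext) (simp add: matrix_unit_mult rel_refl, simp add: matrix_unit_def)
  then have "\<phi> (E x x) \<otimes>\<^bsub>A\<^esub> \<phi> (E x x) = \<phi> (E x x)"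
    using phi_mult[OF unit unit, symmetric] by simp
  moreover have "\<phi> (E x x) z z = \<zero>\<^bsub>F\<^esub>" for z
    using none by (simp add: matched_def)
  ultimately have "\<phi> (E x x) s t = \<zero>\<^bsub>F\<^esub>" for s t
    by (rule idempotent_diagonal[OF phi_closed[OF unit]])
  then have "\<phi> (E x x) = (\<lambda>x y. \<zero>\<^bsub>F\<^esub>)"
    by (intro ext)
  then have "E x x = (\<lambda>x y. \<zero>\<^bsub>F\<^esub>)"
    using psi_phi[OF unit] psi_phi[OF zero_closed] phi_zero by simp
  then have "E x x x x = \<zero>\<^bsub>F\<^esub>"
    by (simp only:)
  then show False
    by (simp add: matrix_unit_def)
qed

text \<open>The argument of \<open>\<phi>\<close> is the corner
  \<open>E x x * \<psi> (E a b) * E y y\<close>, whose image is computed by multiplicativity. The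
  case \<open>x = y\<close>, \<open>a = b\<close> gives uniqueness of the matched position, the
  general case order and degree.\<close>

lemma phi_corner:
  assumes "x \<in> P" "y \<in> P" "(a, b) \<in> r"
  shows "\<phi> (\<psi> (E a b) x y \<odot>\<^bsub>A\<^esub> E x y) = \<phi> (E x x) \<otimes>\<^bsub>A\<^esub> (E a b \<otimes>\<^bsub>A\<^esub> \<phi> (E y y))"
proof -
  note closed = rel_refl matrix_unit_closed psi_closed mult_closed
  have "\<phi> (E x x \<otimes>\<^bsub>A\<^esub> (\<psi> (E a b) \<otimes>\<^bsub>A\<^esub> E y y)) =
      \<phi> (E x x) \<otimes>\<^bsub>A\<^esub> (E a b \<otimes>\<^bsub>A\<^esub> \<phi> (E y y))"
    using assms by (simp add: closed phi_mult phi_psi)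
  then show ?thesis
    using assms by (simp add: corner closed)
qed

text \<open>With \<open>f = \<phi> (E x x)\<close>, \<open>phi_corner\<close> reads
  \<open>c * f = f * E y y * f\<close>, hence \<open>c * f z z = f z y * f y z\<close> for all
  \<open>z\<close>. At \<open>z = y\<close> the right side is a nonzero square, so \<open>c\<close>
  is nonzero; for other \<open>z\<close> antisymmetry kills a factor, so \<open>f z z\<close>
  vanishes. The first claim says that the inverse matches \<open>y\<close> back to
  \<open>x\<close>.\<close>

lemma matched_inverse_unique:
  assumes x: "x \<in> P" and m: "matched x y"
  shows "\<psi> (E y y) x x \<noteq> \<zero>\<^bsub>F\<^esub>" and "matched x z \<Longrightarrow> z = y"
proof -
  define f c where "f = \<phi> (E x x)" and "c = \<psi> (E y y) x x"
  have y: "y \<in> P"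
    using x m by (rule matched_mem)
  have f: "f \<in> carrier A" and c: "c \<in> carrier F"
    using x y
    by (simp_all add: f_def c_def phi_closed psi_closed matrix_unit_closed rel_refl entry_closed)
  have fy: "f y y \<noteq> \<zero>\<^bsub>F\<^esub>"
    using m by (simp add: f_def matched_def)
  have "c \<odot>\<^bsub>A\<^esub> f = f \<otimes>\<^bsub>A\<^esub> (E y y \<otimes>\<^bsub>A\<^esub> f)"
    using phi_corner[OF x x rel_refl[OF y]] x c
    by (simp add: c_def f_def phi_smult matrix_unit_closed rel_refl)
  then have eq: "c \<otimes>\<^bsub>F\<^esub> f z z = f z y \<otimes>\<^bsub>F\<^esub> f y z" for z
    using matrix_unit_sandwich[OF rel_refl[OF y] f f, of z z] smult_apply[of c f z z] by simp
  have "c \<noteq> \<zero>\<^bsub>F\<^esub>"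
    using eq[of y] fy F.integral[of "f y y" "f y y"] entry_closed[OF f, of y y] by auto
  then show "\<psi> (E y y) x x \<noteq> \<zero>\<^bsub>F\<^esub>"
    by (simp add: c_def)
  show "z = y" if "matched x z"
  proof (rule ccontr)
    assume "z \<noteq> y"
    then have "f z y = \<zero>\<^bsub>F\<^esub> \<or> f y z = \<zero>\<^bsub>F\<^esub>"
      using entry_zero[OF f] rel_antisym by blast
    then have "c \<otimes>\<^bsub>F\<^esub> f z z = \<zero>\<^bsub>F\<^esub>"
      using eq f by (auto simp: entry_closed)
    then show False
      using \<open>c \<noteq> \<zero>\<^bsub>F\<^esub>\<close> that c f by (simp add: F.integral_iff entry_closed f_def matched_def)
  qed
qed

lemma matched_rel_degree:
  assumes x: "x \<in> P" and y: "y \<in> P" and ma: "matched x a" and mb: "matched y b"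
    and ab: "(a, b) \<in> r"
  shows "(x, y) \<in> r" and "inv\<^bsub>G\<^esub> (\<theta> x) \<otimes>\<^bsub>G\<^esub> \<theta> y = inv\<^bsub>G\<^esub> (\<mu> a) \<otimes>\<^bsub>G\<^esub> \<mu> b"
proof -
  define u w d where "u = \<phi> (E x x) \<otimes>\<^bsub>A\<^esub> (E a b \<otimes>\<^bsub>A\<^esub> \<phi> (E y y))"
    and "w = \<psi> (E a b) x y \<odot>\<^bsub>A\<^esub> E x y" and "d = inv\<^bsub>G\<^esub> (\<mu> a) \<otimes>\<^bsub>G\<^esub> \<mu> b"
  have muG: "\<mu> z \<in> carrier G" if "z \<in> P" for z
    using that mu by auto
  have abP: "a \<in> P" "b \<in> P"
    using ab relD by auto
  have d: "d \<in> carrier G"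
    using abP muG by (simp add: d_def)
  \<comment> \<open>\<open>E z z\<close> is supported at \<open>(z, z)\<close> only, hence has
    trivial degree, and \<open>\<phi>\<close> preserves degrees.\<close>
  have unit_degree: "\<phi> (E z z) \<in> elementary_grading F G P r \<mu> \<one>\<^bsub>G\<^esub>" if "z \<in> P" for z
  proof (rule phi_graded)
    show "E z z \<in> elementary_grading F G P r \<theta> \<one>\<^bsub>G\<^esub>"
      using that funcset_mem[OF theta that]
      by (simp add: elementary_grading_def matrix_unit_closed rel_refl) (auto simp: matrix_unit_def)
  qed simp
  have closed: "\<phi> (E x x) \<in> carrier A" "\<phi> (E y y) \<in> carrier A"
    using x y by (simp_all add: phi_closed matrix_unit_closed rel_refl)
  have u: "u \<in> carrier A"
    using closed ab by (simp add: u_def mult_closed matrix_unit_closed)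
  have u_apply: "u s t = \<phi> (E x x) s a \<otimes>\<^bsub>F\<^esub> \<phi> (E y y) b t" for s t
    unfolding u_def using ab closed by (rule matrix_unit_sandwich)
  \<comment> \<open>A nonzero entry of \<open>\<phi> (E z z)\<close> therefore joins positions with
    equal \<open>\<mu>\<close>, which gives all nonzero entries of \<open>u\<close> the degree
    \<open>d\<close> of \<open>E a b\<close>.\<close>
  have same_degree: "\<mu> s = \<mu> t"
    if "z \<in> P" "\<phi> (E z z) s t \<noteq> \<zero>\<^bsub>F\<^esub>" for z s t
  proof -
    have "(s, t) \<in> r" "inv\<^bsub>G\<^esub> (\<mu> s) \<otimes>\<^bsub>G\<^esub> \<mu> t = \<one>\<^bsub>G\<^esub>"
      using that unit_degree[OF that(1)]
        entry_zero[OF phi_closed[OF matrix_unit_closed[OF rel_refl[OF that(1)]]]]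
      by (auto simp: elementary_grading_def)
    then show ?thesis
      using muG relD G.inv_solve_left'[of "\<one>\<^bsub>G\<^esub>" "\<mu> s" "\<mu> t"] by auto
  qed
  have "u \<in> elementary_grading F G P r \<mu> d"
  proof -
    have "inv\<^bsub>G\<^esub> (\<mu> s) \<otimes>\<^bsub>G\<^esub> \<mu> t = d" if "u s t \<noteq> \<zero>\<^bsub>F\<^esub>" for s t
    proof -
      have "\<phi> (E x x) s a \<noteq> \<zero>\<^bsub>F\<^esub>" "\<phi> (E y y) b t \<noteq> \<zero>\<^bsub>F\<^esub>"
        using that closed by (auto simp: u_apply entry_closed)
      then have "\<mu> s = \<mu> a" "\<mu> b = \<mu> t"
        using same_degree x y by blast+
      then show ?thesis
        by (simp add: d_def)
    qed
    then show ?thesis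
      using u by (auto simp: elementary_grading_def)
  qed
  moreover have "\<psi> u = w"
  proof -
    \<comment> \<open>At this stage \<open>x \<preceq> y\<close> is unproved, so
      \<open>E x y\<close> is not known to be in the algebra; \<open>w\<close> is, being a
      corner.\<close>
    have "w \<in> carrier A"
    proof -
      have "w = E x x \<otimes>\<^bsub>A\<^esub> (\<psi> (E a b) \<otimes>\<^bsub>A\<^esub> E y y)"
        using x y ab by (simp add: w_def corner psi_closed matrix_unit_closed)
      then show ?thesis
        using x y ab by (simp add: mult_closed psi_closed matrix_unit_closed rel_refl)
    qed
    moreover have "\<phi> w = u"
      using phi_corner[OF x y ab] by (simp add: u_def w_def)
    ultimately show ?thesis
      using psi_phi by blast
  qed
  ultimately have w: "w \<in> elementary_grading F G P r \<theta> d"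
    using psi_graded d by blast
  \<comment> \<open>Otherwise \<open>w\<close> and with it \<open>u\<close> would be zero, whereas
    \<open>u a b\<close> is a product of two nonzero diagonal entries.\<close>
  have "w x y \<noteq> \<zero>\<^bsub>F\<^esub>"
  proof
    have entry: "\<psi> (E a b) x y \<in> carrier F"
      using ab by (simp add: entry_closed psi_closed matrix_unit_closed)
    assume "w x y = \<zero>\<^bsub>F\<^esub>"
    then have "\<psi> (E a b) x y = \<zero>\<^bsub>F\<^esub>"
      using entry by (simp add: w_def smult_apply matrix_unit_def)
    then have "w = (\<lambda>x y. \<zero>\<^bsub>F\<^esub>)"
      by (intro ext) (simp add: w_def smult_apply matrix_unit_def)
    then have "u = (\<lambda>x y. \<zero>\<^bsub>F\<^esub>)"
      using \<open>\<psi> u = w\<close> phi_psi[OF u] phi_zero by simp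
    then have "\<phi> (E x x) a a \<otimes>\<^bsub>F\<^esub> \<phi> (E y y) b b = \<zero>\<^bsub>F\<^esub>"
      using u_apply by metis
    then show False
      using ma mb closed by (simp add: F.integral_iff entry_closed matched_def)
  qed
  \<comment> \<open>A nonzero entry of \<open>w\<close> forces \<open>x \<preceq> y\<close> by the
    support condition, and then the degree by homogeneity.\<close>
  then show "(x, y) \<in> r" "inv\<^bsub>G\<^esub> (\<theta> x) \<otimes>\<^bsub>G\<^esub> \<theta> y = inv\<^bsub>G\<^esub> (\<mu> a) \<otimes>\<^bsub>G\<^esub> \<mu> b"
    using w entry_zero[of w] unfolding elementary_grading_def d_def by blast+
qed

lemma automorphism_exists:
  obtains \<sigma> where "\<sigma> \<in> order_automorphisms P r"
    and "\<And>x y. (x, y) \<in> r \<Longrightarrow>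
      inv\<^bsub>G\<^esub> (\<theta> x) \<otimes>\<^bsub>G\<^esub> \<theta> y = inv\<^bsub>G\<^esub> (\<mu> (\<sigma> x)) \<otimes>\<^bsub>G\<^esub> \<mu> (\<sigma> y)"
proof -
  interpret inv: graded_incidence_iso F P r G \<mu> \<theta> \<psi> \<phi>
    by (rule inverse)
  define \<sigma> \<tau> where "\<sigma> = (\<lambda>x\<in>P. SOME y. matched x y)" and "\<tau> = (\<lambda>y\<in>P. SOME x. inv.matched y x)"
  have sigma: "matched x (\<sigma> x)" if "x \<in> P" for x
    using someI_ex[OF matched_exists[OF that]] that by (simp add: \<sigma>_def)
  have tau: "inv.matched y (\<tau> y)" if "y \<in> P" for y
    using someI_ex[OF inv.matched_exists[OF that]] that by (simp add: \<tau>_def)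
  have mem: "\<sigma> x \<in> P" "\<tau> x \<in> P" if "x \<in> P" for x
    using that matched_mem[OF that sigma[OF that]] inv.matched_mem[OF that tau[OF that]]
    by simp_all
  \<comment> \<open>Matching can be read backwards through the inverse, so uniqueness on both sides
    makes the choices \<open>\<sigma>\<close> and \<open>\<tau>\<close> mutually inverse.\<close>
  have inv_sigma: "inv.matched (\<sigma> x) x" if "x \<in> P" for x
    using matched_inverse_unique(1)[OF that sigma[OF that]] by (simp add: inv.matched_def)
  have inv_tau: "matched (\<tau> y) y" if "y \<in> P" for y
    using inv.matched_inverse_unique(1)[OF that tau[OF that]] by (simp add: matched_def)
  have "bij_betw \<sigma> P P"
  proof (rule bij_betw_byWitness[where f' = \<tau>])
    show "\<forall>x\<in>P. \<tau> (\<sigma> x) = x"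
      by (intro ballI inv.matched_inverse_unique(2)[OF mem(1) inv_sigma tau[OF mem(1)]])
    show "\<forall>y\<in>P. \<sigma> (\<tau> y) = y"
      by (intro ballI matched_inverse_unique(2)[OF mem(2) inv_tau sigma[OF mem(2)]])
  qed (use mem in auto)
  then have "\<sigma> \<in> Bij P"
    by (simp add: Bij_def \<sigma>_def)
  moreover have "(\<sigma> x, \<sigma> y) \<in> r \<longleftrightarrow> (x, y) \<in> r" if "x \<in> P" "y \<in> P" for x y
    using matched_rel_degree(1)[OF that sigma[OF that(1)] sigma[OF that(2)]]
      inv.matched_rel_degree(1)[OF mem(1)[OF that(1)] mem(1)[OF that(2)]
        inv_sigma[OF that(1)] inv_sigma[OF that(2)]]
    by blast
  ultimately have aut: "\<sigma> \<in> order_automorphisms P r"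
    by (simp add: order_automorphisms_def)
  show thesis
  proof (rule that[OF aut])
    fix x y assume xy: "(x, y) \<in> r"
    then have P: "x \<in> P" "y \<in> P"
      using relD by auto
    \<comment> \<open>The swapped interpretation is used because there the known relation is
      \<open>x \<preceq> y\<close> itself, with \<open>x\<close> and \<open>y\<close> as the
      positions matched to \<open>\<sigma> x\<close> and \<open>\<sigma> y\<close>.\<close>
    show "inv\<^bsub>G\<^esub> (\<theta> x) \<otimes>\<^bsub>G\<^esub> \<theta> y = inv\<^bsub>G\<^esub> (\<mu> (\<sigma> x)) \<otimes>\<^bsub>G\<^esub> \<mu> (\<sigma> y)"
      using inv.matched_rel_degree(2)[OF mem(1)[OF P(1)] mem(1)[OF P(2)]
        inv_sigma[OF P(1)] inv_sigma[OF P(2)] xy] by simp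
  qed
qed

end

section \<open>Graded isomorphisms: their inverses, and their construction from order
  automorphisms\<close>

lemma (in incidence) graded_algebra_isomorphicE:
  assumes "group G" "\<theta> \<in> P \<rightarrow> carrier G" "\<mu> \<in> P \<rightarrow> carrier G"
    and "graded_algebra_isomorphic F G A (elementary_grading F G P r \<theta>)
           A (elementary_grading F G P r \<mu>)"
  obtains \<phi> \<psi> where "graded_incidence_iso F P r G \<theta> \<mu> \<phi> \<psi>"
proof -
  obtain \<phi> where iso: "\<phi> \<in> ring_iso A A"
    and smult: "\<And>c f. c \<in> carrier F \<Longrightarrow> f \<in> carrier A \<Longrightarrow> \<phi> (c \<odot>\<^bsub>A\<^esub> f) = c \<odot>\<^bsub>A\<^esub> \<phi> f"
    and graded: "\<And>d. d \<in> carrier G \<Longrightarrow>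
      \<phi> ` elementary_grading F G P r \<theta> d = elementary_grading F G P r \<mu> d"
    using assms(4) by (auto simp: graded_algebra_isomorphic_def)
  define \<psi> where "\<psi> = inv_into (carrier A) \<phi>"
  have bij: "bij_betw \<phi> (carrier A) (carrier A)"
    and hom: "\<And>f g. f \<in> carrier A \<Longrightarrow> g \<in> carrier A \<Longrightarrow> \<phi> (f \<otimes>\<^bsub>A\<^esub> g) = \<phi> f \<otimes>\<^bsub>A\<^esub> \<phi> g"
    using iso by (auto simp: ring_iso_def ring_hom_def)
  have phi: "\<phi> f \<in> carrier A" "\<psi> (\<phi> f) = f" if "f \<in> carrier A" for f
    using bij that by (auto simp: \<psi>_def bij_betw_apply bij_betw_inv_into_left)
  have psi: "\<psi> f \<in> carrier A" "\<phi> (\<psi> f) = f" if "f \<in> carrier A" for f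
    using bij that bij_betw_apply[OF bij_betw_inv_into[OF bij]]
    by (auto simp: \<psi>_def bij_betw_inv_into_right)
  have smult_closed: "c \<odot>\<^bsub>A\<^esub> f \<in> carrier A" if "c \<in> carrier F" "f \<in> carrier A" for c f
    using that by (auto simp: carrier_iff smult_apply)
  have sub: "elementary_grading F G P r \<eta> d \<subseteq> carrier A" for \<eta> d
    by (auto simp: elementary_grading_def)
  have "graded_incidence_iso F P r G \<theta> \<mu> \<phi> \<psi>"
  proof (intro graded_incidence_iso.intro graded_incidence_iso_axioms.intro)
    show "incidence F P r"
      by unfold_locales
    show "\<psi> (f \<otimes>\<^bsub>A\<^esub> g) = \<psi> f \<otimes>\<^bsub>A\<^esub> \<psi> g" if "f \<in> carrier A" "g \<in> carrier A" for f g
      using phi(2)[OF mult_closed[OF psi(1) psi(1)]] that by (simp add: hom psi)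
    show "\<psi> (c \<odot>\<^bsub>A\<^esub> f) = c \<odot>\<^bsub>A\<^esub> \<psi> f" if "c \<in> carrier F" "f \<in> carrier A" for c f
      using phi(2)[OF smult_closed[OF that(1) psi(1)]] that by (simp add: smult psi)
    show "\<phi> f \<in> elementary_grading F G P r \<mu> d"
      if "d \<in> carrier G" "f \<in> elementary_grading F G P r \<theta> d" for d f
      using graded that by blast
    \<comment> \<open>Here the components are mapped onto, and not only into, each other:
      \<open>f\<close> is the image of some \<open>f'\<close> of degree \<open>d\<close>, and
      \<open>\<psi> f = f'\<close>.\<close>
    show "\<psi> f \<in> elementary_grading F G P r \<theta> d"
      if d: "d \<in> carrier G" and f: "f \<in> elementary_grading F G P r \<mu> d" for d f
    proof -
      obtain f' where "f' \<in> elementary_grading F G P r \<theta> d" "f = \<phi> f'"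
        using graded[OF d] f by blast
      then show ?thesis
        using phi(2) sub by (metis subsetD)
    qed
  qed (use assms phi psi hom smult in auto)
  then show thesis
    by (rule that)
qed

text \<open>The isomorphism relabels entries along \<open>\<sigma>\<close>: the entry of the image
  at \<open>(x, y)\<close> is \<open>f (\<sigma> x) (\<sigma> y)\<close>. The degree hypothesis says
  that the \<open>\<theta>\<close>-degree of the old position is the \<open>\<mu>\<close>-degree of
  the new one.\<close>

lemma (in incidence) graded_algebra_isomorphicI:
  assumes \<sigma>: "\<sigma> \<in> order_automorphisms P r"
    and degree: "\<And>x y. (x, y) \<in> r \<Longrightarrow>
      inv\<^bsub>G\<^esub> (\<theta> (\<sigma> x)) \<otimes>\<^bsub>G\<^esub> \<theta> (\<sigma> y) = inv\<^bsub>G\<^esub> (\<mu> x) \<otimes>\<^bsub>G\<^esub> \<mu> y"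
  shows "graded_algebra_isomorphic F G A (elementary_grading F G P r \<theta>)
           A (elementary_grading F G P r \<mu>)"
proof -
  have bij: "bij_betw \<sigma> P P"
    and rel: "\<And>x y. x \<in> P \<Longrightarrow> y \<in> P \<Longrightarrow> (\<sigma> x, \<sigma> y) \<in> r \<longleftrightarrow> (x, y) \<in> r"
    using \<sigma> by (auto simp: order_automorphisms_def Bij_def)
  define \<tau> where "\<tau> = inv_into P \<sigma>"
  have sigma: "\<sigma> x \<in> P" "\<tau> (\<sigma> x) = x" if "x \<in> P" for x
    using bij that by (auto simp: \<tau>_def bij_betw_apply bij_betw_inv_into_left)
  have tau: "\<tau> x \<in> P" "\<sigma> (\<tau> x) = x" if "x \<in> P" for x
    using bij that bij_betw_apply[OF bij_betw_inv_into[OF bij]]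
    by (auto simp: \<tau>_def bij_betw_inv_into_right)
  have rel_tau: "(\<tau> x, \<tau> y) \<in> r \<longleftrightarrow> (x, y) \<in> r" if "x \<in> P" "y \<in> P" for x y
    using rel[of "\<tau> x" "\<tau> y"] tau that by simp
  \<comment> \<open>The test on \<open>r\<close> keeps the result in the algebra and hides the
    values of \<open>\<rho>\<close> outside \<open>P\<close>. The parameter \<open>\<rho>\<close> is
    there because \<open>pull \<tau>\<close> serves as the inverse of
    \<open>pull \<sigma>\<close>.\<close>
  define pull :: "('p \<Rightarrow> 'p) \<Rightarrow> ('p \<Rightarrow> 'p \<Rightarrow> 'f) \<Rightarrow> 'p \<Rightarrow> 'p \<Rightarrow> 'f"
    where "pull \<rho> f = (\<lambda>x y. if (x, y) \<in> r then f (\<rho> x) (\<rho> y) else \<zero>\<^bsub>F\<^esub>)" for \<rho> f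
  have closed: "pull \<rho> f \<in> carrier A" if "f \<in> carrier A" for \<rho> f
    using that by (auto simp: pull_def carrier_iff)
  have pull_tau: "pull \<sigma> (pull \<tau> f) x y = f x y"
    and pull_sigma: "pull \<tau> (pull \<sigma> f) x y = f x y" if "f \<in> carrier A" for f x y
  proof (atomize (full), cases "(x, y) \<in> r")
    case True
    then show "pull \<sigma> (pull \<tau> f) x y = f x y \<and> pull \<tau> (pull \<sigma> f) x y = f x y"
      using relD[OF True] by (simp add: pull_def sigma tau rel rel_tau)
  next
    case False
    then show "pull \<sigma> (pull \<tau> f) x y = f x y \<and> pull \<tau> (pull \<sigma> f) x y = f x y"
      using that by (simp add: pull_def entry_zero)
  qed
  have bij_pull: "bij_betw (pull \<sigma>) (carrier A) (carrier A)"
    by (rule bij_betw_byWitness[where f' = "pull \<tau>"])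
      (use closed pull_tau pull_sigma in \<open>auto simp: fun_eq_iff\<close>)
  have mult: "pull \<sigma> (f \<otimes>\<^bsub>A\<^esub> g) = pull \<sigma> f \<otimes>\<^bsub>A\<^esub> pull \<sigma> g"
    if f: "f \<in> carrier A" and g: "g \<in> carrier A" for f g
  proof (intro ext)
    fix x y
    show "pull \<sigma> (f \<otimes>\<^bsub>A\<^esub> g) x y = (pull \<sigma> f \<otimes>\<^bsub>A\<^esub> pull \<sigma> g) x y"
    proof (cases "(x, y) \<in> r")
      case True
      have xy: "x \<in> P" "y \<in> P"
        using relD[OF True] by auto
      \<comment> \<open>Since \<open>\<sigma>\<close> carries segments onto segments, the sum for
        the product at \<open>(\<sigma> x, \<sigma> y)\<close> can be reindexed over the segment
        from \<open>x\<close> to \<open>y\<close>.\<close>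
      have seg: "segment P r (\<sigma> x) (\<sigma> y) = \<sigma> ` segment P r x y"
      proof
        show "\<sigma> ` segment P r x y \<subseteq> segment P r (\<sigma> x) (\<sigma> y)"
          using xy by (auto simp: segment_def sigma rel)
        show "segment P r (\<sigma> x) (\<sigma> y) \<subseteq> \<sigma> ` segment P r x y"
        proof
          fix z assume z: "z \<in> segment P r (\<sigma> x) (\<sigma> y)"
          then have zP: "z \<in> P"
            by (simp add: segment_def)
          then have "\<tau> z \<in> segment P r x y"
            using z xy rel[of x "\<tau> z"] rel[of "\<tau> z" y] by (simp add: segment_def tau)
          then show "z \<in> \<sigma> ` segment P r x y"
            using tau(2)[OF zP] by (metis imageI)
        qed
      qed
      have "inj_on \<sigma> (segment P r x y)"
        using bij by (auto simp: bij_betw_def segment_def intro: inj_on_subset)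
      then have "(f \<otimes>\<^bsub>A\<^esub> g) (\<sigma> x) (\<sigma> y) =
          (\<Oplus>\<^bsub>F\<^esub>z\<in>segment P r x y. f (\<sigma> x) (\<sigma> z) \<otimes>\<^bsub>F\<^esub> g (\<sigma> z) (\<sigma> y))"
        unfolding mult_apply seg using f g
        by (intro F.add.finprod_reindex) (auto simp: entry_closed)
      also have "\<dots> = (pull \<sigma> f \<otimes>\<^bsub>A\<^esub> pull \<sigma> g) x y"
        unfolding mult_apply using f g
        by (intro F.finsum_cong') (auto simp: pull_def segment_def entry_closed)
      finally show ?thesis
        using True by (simp add: pull_def)
    next
      case False
      then show ?thesis
        using f g by (simp add: entry_zero closed mult_closed)
    qed
  qed
  have one: "pull \<sigma> \<one>\<^bsub>A\<^esub> = \<one>\<^bsub>A\<^esub>"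
  proof (intro ext)
    fix x y
    show "pull \<sigma> \<one>\<^bsub>A\<^esub> x y = \<one>\<^bsub>A\<^esub> x y"
    proof (cases "(x, y) \<in> r")
      case True
      then have "x \<in> P" "y \<in> P" "\<sigma> x = \<sigma> y \<longleftrightarrow> x = y"
        using relD[OF True] bij by (auto simp: bij_betw_def inj_on_eq_iff)
      then show ?thesis
        using True by (simp add: pull_def incidence_algebra_def sigma)
    next
      case False
      then show ?thesis
        using rel_refl by (auto simp: pull_def incidence_algebra_def)
    qed
  qed
  have add: "pull \<sigma> (f \<oplus>\<^bsub>A\<^esub> g) = pull \<sigma> f \<oplus>\<^bsub>A\<^esub> pull \<sigma> g" for f g
    by (auto simp: fun_eq_iff pull_def incidence_algebra_def)
  have "pull \<sigma> \<in> ring_iso A A"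
    using bij_pull closed mult one add by (simp add: ring_iso_def ring_hom_def)
  moreover have "pull \<sigma> (c \<odot>\<^bsub>A\<^esub> f) = c \<odot>\<^bsub>A\<^esub> pull \<sigma> f" if "c \<in> carrier F" for c f
    using that by (auto simp: fun_eq_iff pull_def smult_apply)
  moreover have "pull \<sigma> ` elementary_grading F G P r \<theta> d = elementary_grading F G P r \<mu> d" for d
  proof
    show "pull \<sigma> ` elementary_grading F G P r \<theta> d \<subseteq> elementary_grading F G P r \<mu> d"
    proof (rule image_subsetI)
      fix f assume f: "f \<in> elementary_grading F G P r \<theta> d"
      have "f (\<sigma> x) (\<sigma> y) = \<zero>\<^bsub>F\<^esub>"
        if "(x, y) \<in> r" "inv\<^bsub>G\<^esub> (\<mu> x) \<otimes>\<^bsub>G\<^esub> \<mu> y \<noteq> d" for x y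
        using f that degree[OF that(1)] relD[OF that(1)] rel[of x y]
        by (simp add: elementary_grading_def)
      then show "pull \<sigma> f \<in> elementary_grading F G P r \<mu> d"
        using f closed by (simp add: elementary_grading_def pull_def)
    qed
    show "elementary_grading F G P r \<mu> d \<subseteq> pull \<sigma> ` elementary_grading F G P r \<theta> d"
    proof
      fix f assume f: "f \<in> elementary_grading F G P r \<mu> d"
      then have fA: "f \<in> carrier A"
        by (simp add: elementary_grading_def)
      \<comment> \<open>The preimage of \<open>f\<close> is \<open>pull \<tau> f\<close>; its
        homogeneity follows from the degree hypothesis at \<open>\<tau> x\<close> and
        \<open>\<tau> y\<close>.\<close>
      have "inv\<^bsub>G\<^esub> (\<mu> (\<tau> x)) \<otimes>\<^bsub>G\<^esub> \<mu> (\<tau> y) = inv\<^bsub>G\<^esub> (\<theta> x) \<otimes>\<^bsub>G\<^esub> \<theta> y" if "(x, y) \<in> r" for x y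
        using degree[of "\<tau> x" "\<tau> y"] relD[OF that] that by (simp add: rel_tau tau)
      then have "pull \<tau> f \<in> elementary_grading F G P r \<theta> d"
        using f closed[OF fA] rel_tau relD unfolding elementary_grading_def pull_def
        by auto
      then show "f \<in> pull \<sigma> ` elementary_grading F G P r \<theta> d"
        using pull_tau[OF fA] by (intro image_eqI ext) simp_all
    qed
  qed
  ultimately show ?thesis
    unfolding graded_algebra_isomorphic_def by blast
qed

section \<open>Connected components and their enumeration\<close>

lemma component_index_exists:
  assumes "bij_betw C {1..k} (connected_components P r)" "x \<in> P"
  obtains i where "i \<in> {1..k}" "x \<in> C i"
proof -
  let ?K = "{(x, y) \<in> P \<times> P. (x, y) \<in> (r \<union> r\<inverse>)\<^sup>*} `` {x}"
  have "?K \<in> connected_components P r"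
    using assms(2) unfolding connected_components_def by (rule quotientI)
  then obtain i where "i \<in> {1..k}" "?K = C i"
    using assms(1) unfolding bij_betw_def by blast
  moreover have "x \<in> ?K"
    using assms(2) by simp
  ultimately show thesis
    using that by simp
qed

text \<open>Any point of a class can serve as its representative, since chains of comparable
  elements can be reversed and concatenated.\<close>

lemma component_relD:
  assumes "bij_betw C {1..k} (connected_components P r)" "i \<in> {1..k}" "x \<in> C i"
  shows "C i = {y \<in> P. (x, y) \<in> (r \<union> r\<inverse>)\<^sup>*}"
proof -
  have sym: "sym ((r \<union> r\<inverse>)\<^sup>*)"
    by (intro sym_rtrancl) (auto simp: sym_def)
  have "C i \<in> connected_components P r"
    using assms unfolding bij_betw_def by blast
  then obtain z where "z \<in> P" and "C i = {(x, y) \<in> P \<times> P. (x, y) \<in> (r \<union> r\<inverse>)\<^sup>*} `` {z}"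
    unfolding connected_components_def by (rule quotientE)
  then have C: "C i = {y \<in> P. (z, y) \<in> (r \<union> r\<inverse>)\<^sup>*}"
    by (simp add: Image_def)
  then have zx: "(z, x) \<in> (r \<union> r\<inverse>)\<^sup>*" and xz: "(x, z) \<in> (r \<union> r\<inverse>)\<^sup>*"
    using assms(3) sym by (simp_all add: symD)
  have "(z, y) \<in> (r \<union> r\<inverse>)\<^sup>* \<longleftrightarrow> (x, y) \<in> (r \<union> r\<inverse>)\<^sup>*" for y
    using rtrancl_trans[OF zx, of y] rtrancl_trans[OF xz, of y] by blast
  then show ?thesis
    by (simp add: C)
qed

text \<open>Evaluates the index occurring in \<open>left_act\<close>: classes sharing a point
  coincide, and the enumeration is injective.\<close>

lemma component_index_eq:
  assumes "bij_betw C {1..k} (connected_components P r)" "i \<in> {1..k}" "x \<in> C i"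
  shows "(THE i. i \<in> {1..k} \<and> x \<in> C i) = i"
proof (rule the_equality)
  fix j assume j: "j \<in> {1..k} \<and> x \<in> C j"
  then have "C j = C i"
    using component_relD[OF assms(1), of j x] component_relD[OF assms] by simp
  then show "j = i"
    using assms(1,2) j unfolding bij_betw_def by (blast dest: inj_onD)
qed (use assms in simp)

section \<open>Equivalence of elementary maps in terms of degrees\<close>

text \<open>The left factor at \<open>x\<close> has to be \<open>q x\<close>. Equality of degrees
  makes \<open>q\<close> agree at comparable points, hence along chains, so it depends on the
  component only and defines \<open>h\<close>.\<close>

lemma elementary_equivI:
  assumes comp: "bij_betw C {1..k} (connected_components P r)" and "group G"
    and rel: "r \<subseteq> P \<times> P"
    and \<theta>: "\<theta> \<in> P \<rightarrow>\<^sub>E carrier G" and \<mu>: "\<mu> \<in> P \<rightarrow> carrier G"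
    and \<sigma>: "\<sigma> \<in> order_automorphisms P r"
    and degree: "\<And>x y. (x, y) \<in> r \<Longrightarrow>
      inv\<^bsub>G\<^esub> (\<theta> x) \<otimes>\<^bsub>G\<^esub> \<theta> y = inv\<^bsub>G\<^esub> (\<mu> (\<sigma> x)) \<otimes>\<^bsub>G\<^esub> \<mu> (\<sigma> y)"
  shows "elementary_equiv G P r k C \<theta> \<mu>"
proof -
  interpret group G by fact
  define q where "q x = \<theta> x \<otimes>\<^bsub>G\<^esub> inv\<^bsub>G\<^esub> (\<mu> (\<sigma> x))" for x
  have bij: "bij_betw \<sigma> P P"
    using \<sigma> by (auto simp: order_automorphisms_def Bij_def)
  have G: "\<theta> x \<in> carrier G" "\<mu> (\<sigma> x) \<in> carrier G" if "x \<in> P" for x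
    using that \<theta> \<mu> bij by (auto dest: bij_betw_apply)
  have q_rel: "q x = q y" if xy: "(x, y) \<in> r" for x y
  proof -
    have P: "x \<in> P" "y \<in> P"
      using xy rel by auto
    have "\<theta> y = \<theta> x \<otimes>\<^bsub>G\<^esub> (inv\<^bsub>G\<^esub> (\<mu> (\<sigma> x)) \<otimes>\<^bsub>G\<^esub> \<mu> (\<sigma> y))"
      using P G inv_solve_left'[of "inv\<^bsub>G\<^esub> (\<mu> (\<sigma> x)) \<otimes>\<^bsub>G\<^esub> \<mu> (\<sigma> y)" "\<theta> x" "\<theta> y"] degree[OF xy]
      by simp
    then show ?thesis
      using P G by (simp add: q_def m_assoc)
  qed
  have q_const: "q x = q y" if "(x, y) \<in> (r \<union> r\<inverse>)\<^sup>*" for x y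
    using that by induction (auto dest: q_rel)
  define h where "h = (\<lambda>i\<in>{1..k}. q (SOME x. x \<in> C i))"
  have h: "h i = q x" if "i \<in> {1..k}" "x \<in> C i" for i x
  proof -
    have "(SOME x. x \<in> C i) \<in> C i"
      using that(2) by (rule someI)
    then show ?thesis
      using that component_relD[OF comp that] q_const by (auto simp: h_def)
  qed
  \<comment> \<open>This ensures that the choice made in \<open>h\<close> yields a genuine point of
    the component, and so a value in the group.\<close>
  have nonempty: "\<exists>x\<in>P. x \<in> C i" if "i \<in> {1..k}" for i
  proof -
    have "C i \<in> connected_components P r"
      using comp that by (auto simp: bij_betw_def)
    then obtain x where "x \<in> P" "C i = {(x, y) \<in> P \<times> P. (x, y) \<in> (r \<union> r\<inverse>)\<^sup>*} `` {x}"
      unfolding connected_components_def by (rule quotientE)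
    then show ?thesis
      by (intro bexI[of _ x]) simp_all
  qed
  have "h \<in> carrier (product_group {1..k} (\<lambda>_. G))"
  proof -
    have "h i \<in> carrier G" if "i \<in> {1..k}" for i
      using nonempty[OF that] h[OF that] G by (auto simp: q_def)
    moreover have "h \<in> extensional {1..k}"
      unfolding h_def by (rule restrict_extensional)
    ultimately show ?thesis
      by (auto simp: PiE_def)
  qed
  \<comment> \<open>\<open>right_act\<close> composes with the inverse of its automorphism, so the
    witness is the inverse of \<open>\<sigma>\<close>, restricted to \<open>P\<close> because
    members of \<open>Bij P\<close> are extensional.\<close>
  moreover define \<tau> where "\<tau> = restrict (inv_into P \<sigma>) P"
  have "\<tau> \<in> Bij P"
    using restrict_inv_into_Bij \<sigma> by (auto simp: \<tau>_def order_automorphisms_def)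
  have tau: "\<tau> x \<in> P" "\<sigma> (\<tau> x) = x" "\<tau> (\<sigma> x) = x" if "x \<in> P" for x
    using that bij bij_betw_apply[OF bij_betw_inv_into[OF bij]]
    by (auto simp: \<tau>_def bij_betw_inv_into_right bij_betw_inv_into_left bij_betw_apply)
  have "(\<tau> x, \<tau> y) \<in> r \<longleftrightarrow> (x, y) \<in> r" if "x \<in> P" "y \<in> P" for x y
  proof -
    have "(\<sigma> (\<tau> x), \<sigma> (\<tau> y)) \<in> r \<longleftrightarrow> (\<tau> x, \<tau> y) \<in> r"
      using \<sigma> tau(1)[OF that(1)] tau(1)[OF that(2)] unfolding order_automorphisms_def by blast
    then show ?thesis
      using tau that by simp
  qed
  then have "\<tau> \<in> order_automorphisms P r"
    using \<open>\<tau> \<in> Bij P\<close> by (simp add: order_automorphisms_def)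
  moreover have "\<theta> = left_act G P k C h (right_act P \<mu> \<tau>)"
  proof (rule extensionalityI)
    show "\<theta> \<in> extensional P"
      using \<theta> by (auto simp: PiE_def)
    show "left_act G P k C h (right_act P \<mu> \<tau>) \<in> extensional P"
      unfolding left_act_def by (rule restrict_extensional)
    fix x assume x: "x \<in> P"
    obtain i where i: "i \<in> {1..k}" "x \<in> C i"
      using comp x by (rule component_index_exists)
    have "inv_into P \<tau> x = \<sigma> x"
      using \<open>\<tau> \<in> Bij P\<close> x bij tau
      by (intro inv_into_f_eq) (auto simp: Bij_def bij_betw_def)
    then have "left_act G P k C h (right_act P \<mu> \<tau>) x = q x \<otimes>\<^bsub>G\<^esub> \<mu> (\<sigma> x)"
      using x h[OF i] component_index_eq[OF comp i] by (simp add: left_act_def right_act_def)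
    also have "\<dots> = \<theta> x"
      using G[OF x] by (simp add: q_def m_assoc)
    finally show "\<theta> x = left_act G P k C h (right_act P \<mu> \<tau>) x"
      by simp
  qed
  ultimately show ?thesis
    unfolding elementary_equiv_def by blast
qed

text \<open>For \<open>x \<preceq> y\<close> the points \<open>\<sigma> x\<close> and
  \<open>\<sigma> y\<close> lie in one component, so \<open>\<theta> (\<sigma> x)\<close> and
  \<open>\<theta> (\<sigma> y)\<close> are \<open>\<mu> x\<close> and \<open>\<mu> y\<close>
  multiplied on the left by the same \<open>h i\<close>, which cancels in the degree.\<close>

lemma elementary_equivD:
  assumes comp: "bij_betw C {1..k} (connected_components P r)" and "group G"
    and rel: "r \<subseteq> P \<times> P" and \<mu>: "\<mu> \<in> P \<rightarrow> carrier G"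
    and equiv: "elementary_equiv G P r k C \<theta> \<mu>"
  obtains \<sigma> where "\<sigma> \<in> order_automorphisms P r"
    and "\<And>x y. (x, y) \<in> r \<Longrightarrow>
      inv\<^bsub>G\<^esub> (\<theta> (\<sigma> x)) \<otimes>\<^bsub>G\<^esub> \<theta> (\<sigma> y) = inv\<^bsub>G\<^esub> (\<mu> x) \<otimes>\<^bsub>G\<^esub> \<mu> y"
proof -
  interpret group G by fact
  obtain h \<sigma> where h: "h \<in> carrier (product_group {1..k} (\<lambda>_. G))"
    and \<sigma>: "\<sigma> \<in> order_automorphisms P r"
    and \<theta>: "\<theta> = left_act G P k C h (right_act P \<mu> \<sigma>)"
    using equiv by (auto simp: elementary_equiv_def)
  have bij: "bij_betw \<sigma> P P"
    using \<sigma> by (auto simp: order_automorphisms_def Bij_def)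
  show thesis
  proof (rule that[OF \<sigma>])
    fix x y assume xy: "(x, y) \<in> r"
    then have P: "x \<in> P" "y \<in> P"
      using rel by auto
    then have \<sigma>P: "\<sigma> x \<in> P" "\<sigma> y \<in> P"
      using bij by (auto dest: bij_betw_apply)
    have "(\<sigma> x, \<sigma> y) \<in> r"
      using \<sigma> xy P by (auto simp: order_automorphisms_def)
    then have conn: "(\<sigma> x, \<sigma> y) \<in> (r \<union> r\<inverse>)\<^sup>*"
      by auto
    obtain i where i: "i \<in> {1..k}" "\<sigma> x \<in> C i"
      using comp \<sigma>P(1) by (rule component_index_exists)
    have iy: "\<sigma> y \<in> C i"
      using component_relD[OF comp i] conn \<sigma>P by simp
    have hi: "h i \<in> carrier G"
      using h i by (auto simp: PiE_def)
    have \<mu>G: "\<mu> x \<in> carrier G" "\<mu> y \<in> carrier G"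
      using P \<mu> by auto
    have "\<theta> (\<sigma> x) = h i \<otimes>\<^bsub>G\<^esub> \<mu> x" "\<theta> (\<sigma> y) = h i \<otimes>\<^bsub>G\<^esub> \<mu> y"
      using P \<sigma>P bij component_index_eq[OF comp i] component_index_eq[OF comp i(1) iy]
      by (simp_all add: \<theta> left_act_def right_act_def bij_betw_inv_into_left)
    then show "inv\<^bsub>G\<^esub> (\<theta> (\<sigma> x)) \<otimes>\<^bsub>G\<^esub> \<theta> (\<sigma> y) = inv\<^bsub>G\<^esub> (\<mu> x) \<otimes>\<^bsub>G\<^esub> \<mu> y"
      using hi \<mu>G m_assoc[of "inv\<^bsub>G\<^esub> h i" "h i" "\<mu> y", symmetric]
      by (simp add: inv_mult_group m_assoc)
  qed
qed

theorem theorem3p8: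
  fixes F :: "('f, 'm) ring_scheme" and G :: "('g, 'n) monoid_scheme"
    and P :: "'p set" and r :: "'p rel"
    and k :: nat and C :: "nat \<Rightarrow> 'p set" and \<theta> \<mu> :: "'p \<Rightarrow> 'g"
  assumes "locally_finite_poset P r"
    and "bij_betw C {1..k} (connected_components P r)"
    and "field F"
    and "group G"
    and "\<theta> \<in> elementary_maps G P r"
    and "\<mu> \<in> elementary_maps G P r"
  shows "graded_algebra_isomorphic F G
           (incidence_algebra F P r) (elementary_grading F G P r \<theta>)
           (incidence_algebra F P r) (elementary_grading F G P r \<mu>)
         \<longleftrightarrow> elementary_equiv G P r k C \<theta> \<mu>"
    (is "?iso \<longleftrightarrow> ?equiv")
proof -
  interpret incidence F P r
    using assms by (simp add: incidence_def incidence_axioms_def)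
  have rel: "r \<subseteq> P \<times> P"
    using relD by auto
  \<comment> \<open>\<open>\<theta>\<close> keeps its extensionality because
    \<open>elementary_equiv\<close> asserts an equality of functions on the whole type.\<close>
  have \<theta>: "\<theta> \<in> P \<rightarrow>\<^sub>E carrier G" and \<mu>: "\<mu> \<in> P \<rightarrow> carrier G"
    using assms by (auto simp: elementary_maps_def)
  show ?thesis
  proof
    assume ?iso
    then obtain \<phi> \<psi> where "graded_incidence_iso F P r G \<theta> \<mu> \<phi> \<psi>"
      using graded_algebra_isomorphicE assms(4) \<theta> \<mu> by (metis PiE_iff Pi_I)
    then show ?equiv
      using graded_incidence_iso.automorphism_exists
        elementary_equivI[OF assms(2,4) rel \<theta> \<mu>] by metis
  next
    assume ?equiv
    \<comment> \<open>This direction compares \<open>\<theta>\<close> after \<open>\<sigma>\<close>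
      with \<open>\<mu>\<close>, whereas the previous one compares \<open>\<theta>\<close> with
      \<open>\<mu>\<close> after \<open>\<sigma>\<close>.\<close>
    then show ?iso
      using elementary_equivD[OF assms(2,4) rel \<mu>] graded_algebra_isomorphicI by metis
  qed
qed

end
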